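(* Let $n\ge1$ and $k\ge0$ be integers and let $(C,A)$, $A\in\mathcal{L}(\mathcal{X})$, $C\in\mathcal{L}(\mathcal{X},\mathcal{Y})$, be an $n$-output-stable and exactly $n$-observable pair. Then the reproducing kernel for the space $S_n^k\operatorname{Ran}\mathfrak{O}_{n,k,C,A}$ (with inner product induced by $\mathcal{A}_n(\mathcal{Y})$) is $$\mathfrak{K}_k(z,\zeta)=z^k\overline{\zeta}^k\,CR_{n,k}(zA)\,\mathfrak{G}_{n,k,C,A}^{-1}\,R_{n,k}(\zeta A)^*C^*.$$
   Context: $\mathcal{A}_n(\mathcal{Y})$ is the Hilbert space of $\mathcal{Y}$-valued functions $f(z)=\sum_{j\ge0}f_jz^j$ analytic on the open unit disk with $\|f\|^2=\sum_{j\ge0}\mu_{n,j}\|f_j\|^2<\infty$, $\mu_{n,j}=1/\binom{n+j-1}{j}$; $S_n:f(z)\mapsto zf(z)$. $R_{n,k}(zA)=\sum_{j\ge0}\binom{n+j+k-1}{j+k}A^jz^j$. The operator $\mathfrak{O}_{n,k,C,A}:\mathcal{X}\to\mathcal{A}_n(\mathcal{Y})$ is $x\mapsto CR_{n,k}(zA)x=\sum_{j\ge0}\binom{n+j+k-1}{j+k}(CA^jx)z^j$, and $\mathfrak{G}_{n,k,C,A}=\sum_{j\ge0}\binom{n+j+k-1}{j+k}A^{*j}C^*CA^j$ (strong convergence). The pair $(C,A)$ is $n$-output-stable if $\mathcal{O}_{n,C,A}=\mathfrak{O}_{n,0,C,A}$ is bounded from $\mathcal{X}$ to $\mathcal{A}_n(\mathcal{Y})$,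 and exactly $n$-observable if $\mathcal{G}_{n,C,A}=\mathfrak{G}_{n,0,C,A}$ is bounded and bounded below (in which case $\mathfrak{G}_{n,k,C,A}$ is bounded and bounded below for all $k\ge0$). *)

theory Defs
  imports "HOL-Analysis.Analysis"
begin

text \<open>Complex Hilbert spaces. The inner product is linear in its first argument.\<close>

class complex_hilbert = banach +
  fixes scaleC :: "complex \<Rightarrow> 'a \<Rightarrow> 'a" (infixr "*\<^sub>C" 75)
    and cinner :: "'a \<Rightarrow> 'a \<Rightarrow> complex"
  assumes scaleC_add_right: "c *\<^sub>C (x + y) = c *\<^sub>C x + c *\<^sub>C y"
    and scaleC_add_left: "(c + d) *\<^sub>C x = c *\<^sub>C x + d *\<^sub>C x"
    and scaleC_scaleC: "c *\<^sub>C (d *\<^sub>C x) = (c * d) *\<^sub>C x"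
    and scaleC_of_real: "complex_of_real r *\<^sub>C x = r *\<^sub>R x"
    and cinner_commute: "cinner x y = cnj (cinner y x)"
    and cinner_add_left: "cinner (x + y) z = cinner x z + cinner y z"
    and cinner_scaleC_left: "cinner (c *\<^sub>C x) y = c * cinner x y"
    and cinner_self: "cinner x x = complex_of_real ((norm x)\<^sup>2)"

instantiation complex :: complex_hilbert
begin

definition scaleC_complex :: "complex \<Rightarrow> complex \<Rightarrow> complex"
  where "scaleC_complex c x = c * x"

definition cinner_complex :: "complex \<Rightarrow> complex \<Rightarrow> complex"
  where "cinner_complex x y = x * cnj y"

instance
  by standard
    (simp_all add: scaleC_complex_def cinner_complex_def algebra_simps scaleR_conv_of_real
      complex_norm_square flip: of_real_power)

end

definition bounded_clinear :: "('x::complex_hilbert \<Rightarrow> 'y::complex_hilbert) \<Rightarrow> bool"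
  where "bounded_clinear T \<longleftrightarrow>
    bounded_linear T \<and> (\<forall>c x. T (c *\<^sub>C x) = c *\<^sub>C T x)"

definition bounded_below :: "('x::complex_hilbert \<Rightarrow> 'y::complex_hilbert) \<Rightarrow> bool"
  where "bounded_below T \<longleftrightarrow> (\<exists>\<epsilon>>0. \<forall>x. \<epsilon> * norm x \<le> norm (T x))"

text \<open>The Hilbert space adjoint; it exists (and is unique) for bounded operators.\<close>

definition cadjoint :: "('x::complex_hilbert \<Rightarrow> 'y::complex_hilbert) \<Rightarrow> 'y \<Rightarrow> 'x"
  where "cadjoint T = (THE U. \<forall>x y. cinner (T x) y = cinner x (U y))"

text \<open>
  The weight \<open>\<mu>\<^sub>n\<^sub>,\<^sub>j\<close> and the space \<open>\<A>\<^sub>n(\<Y>)\<close>. A function on the open unit disk is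
  represented by its extension by \<open>0\<close> to the whole plane, so that equality of functions
  on the disk is equality in HOL.
\<close>

definition bergman_weight :: "nat \<Rightarrow> nat \<Rightarrow> real"
  where "bergman_weight n j = 1 / real ((n + j - 1) choose j)"

definition bergman_space :: "nat \<Rightarrow> (complex \<Rightarrow> 'y::complex_hilbert) set"
  where "bergman_space n = {f.
    (\<exists>c. (\<forall>z. norm z < 1 \<longrightarrow> (\<lambda>j. z ^ j *\<^sub>C c j) sums f z) \<and>
         summable (\<lambda>j. bergman_weight n j * (norm (c j))\<^sup>2)) \<and>
    (\<forall>z. \<not> norm z < 1 \<longrightarrow> f z = 0)}"

definition taylor_coeff :: "(complex \<Rightarrow> 'y::complex_hilbert) \<Rightarrow> nat \<Rightarrow> 'y"
  where "taylor_coeff f = (THE c. \<forall>z. norm z < 1 \<longrightarrow> (\<lambda>j. z ^ j *\<^sub>C c j) sums f z)"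

definition bergman_inner ::
    "nat \<Rightarrow> (complex \<Rightarrow> 'y::complex_hilbert) \<Rightarrow> (complex \<Rightarrow> 'y) \<Rightarrow> complex"
  where "bergman_inner n f g =
    (\<Sum>j. complex_of_real (bergman_weight n j) * cinner (taylor_coeff f j) (taylor_coeff g j))"

definition bergman_norm :: "nat \<Rightarrow> (complex \<Rightarrow> 'y::complex_hilbert) \<Rightarrow> real"
  where "bergman_norm n f = sqrt (\<Sum>j. bergman_weight n j * (norm (taylor_coeff f j))\<^sup>2)"

definition bergman_shift :: "(complex \<Rightarrow> 'y::complex_hilbert) \<Rightarrow> complex \<Rightarrow> 'y"
  where "bergman_shift f = (\<lambda>z. z *\<^sub>C f z)"

text \<open>\<open>R\<^sub>n\<^sub>,\<^sub>k(zA)\<close>, with the operator series summed pointwise.\<close>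

definition resolvent_op ::
    "nat \<Rightarrow> nat \<Rightarrow> ('x::complex_hilbert \<Rightarrow> 'x) \<Rightarrow> complex \<Rightarrow> 'x \<Rightarrow> 'x"
  where "resolvent_op n k A z x =
    (\<Sum>j. (of_nat ((n + j + k - 1) choose (j + k)) * z ^ j) *\<^sub>C (A ^^ j) x)"

definition observability_op ::
    "nat \<Rightarrow> nat \<Rightarrow> ('x::complex_hilbert \<Rightarrow> 'y::complex_hilbert) \<Rightarrow> ('x \<Rightarrow> 'x) \<Rightarrow>
      'x \<Rightarrow> complex \<Rightarrow> 'y"
  where "observability_op n k C A x = (\<lambda>z. if norm z < 1
    then \<Sum>j. (of_nat ((n + j + k - 1) choose (j + k)) * z ^ j) *\<^sub>C C ((A ^^ j) x) else 0)"

definition gramian_term ::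
    "nat \<Rightarrow> nat \<Rightarrow> ('x::complex_hilbert \<Rightarrow> 'y::complex_hilbert) \<Rightarrow> ('x \<Rightarrow> 'x) \<Rightarrow>
      nat \<Rightarrow> 'x \<Rightarrow> 'x"
  where "gramian_term n k C A j x =
    real ((n + j + k - 1) choose (j + k)) *\<^sub>R
      (cadjoint A ^^ j) (cadjoint C (C ((A ^^ j) x)))"

definition gramian ::
    "nat \<Rightarrow> nat \<Rightarrow> ('x::complex_hilbert \<Rightarrow> 'y::complex_hilbert) \<Rightarrow> ('x \<Rightarrow> 'x) \<Rightarrow> 'x \<Rightarrow> 'x"
  where "gramian n k C A x = (\<Sum>j. gramian_term n k C A j x)"

definition output_stable ::
    "nat \<Rightarrow> ('x::complex_hilbert \<Rightarrow> 'y::complex_hilbert) \<Rightarrow> ('x \<Rightarrow> 'x) \<Rightarrow> bool"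
  where "output_stable n C A \<longleftrightarrow>
    (\<forall>x. observability_op n 0 C A x \<in> bergman_space n) \<and>
    (\<exists>M. \<forall>x. bergman_norm n (observability_op n 0 C A x) \<le> M * norm x)"

definition exactly_observable ::
    "nat \<Rightarrow> ('x::complex_hilbert \<Rightarrow> 'y::complex_hilbert) \<Rightarrow> ('x \<Rightarrow> 'x) \<Rightarrow> bool"
  where "exactly_observable n C A \<longleftrightarrow>
    (\<forall>x. summable (\<lambda>j. gramian_term n 0 C A j x)) \<and>
    bounded_clinear (gramian n 0 C A) \<and> bounded_below (gramian n 0 C A)"

text \<open>
  \<open>H\<close> with the inner product induced by \<open>\<A>\<^sub>n(\<Y>)\<close> is a Hilbert space, that is, a complete
  linear subspace of \<open>\<A>\<^sub>n(\<Y>)\<close>.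
\<close>

definition bergman_hilbert_subspace :: "nat \<Rightarrow> (complex \<Rightarrow> 'y::complex_hilbert) set \<Rightarrow> bool"
  where "bergman_hilbert_subspace n H \<longleftrightarrow>
    H \<subseteq> bergman_space n \<and>
    (\<lambda>_. 0) \<in> H \<and>
    (\<forall>f\<in>H. \<forall>g\<in>H. (\<lambda>z. f z + g z) \<in> H) \<and>
    (\<forall>c. \<forall>f\<in>H. (\<lambda>z. c *\<^sub>C f z) \<in> H) \<and>
    (\<forall>F. (\<forall>i. F i \<in> H) \<longrightarrow>
      (\<forall>e>0. \<exists>N. \<forall>i\<ge>N. \<forall>j\<ge>N. bergman_norm n (\<lambda>z. F i z - F j z) < e) \<longrightarrow>
      (\<exists>f\<in>H. (\<lambda>i. bergman_norm n (\<lambda>z. F i z - f z)) \<longlonglongrightarrow> 0))"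

text \<open>
  \<open>K\<close> is the \<open>\<L>(\<Y>)\<close>-valued reproducing kernel on the disk of the space \<open>H\<close>, equipped
  with the inner product induced by \<open>\<A>\<^sub>n(\<Y>)\<close>.
\<close>

definition reproducing_kernel ::
    "nat \<Rightarrow> (complex \<Rightarrow> 'y::complex_hilbert) set \<Rightarrow> (complex \<Rightarrow> complex \<Rightarrow> 'y \<Rightarrow> 'y) \<Rightarrow> bool"
  where "reproducing_kernel n H K \<longleftrightarrow>
    bergman_hilbert_subspace n H \<and>
    (\<forall>z \<zeta>. norm z < 1 \<longrightarrow> norm \<zeta> < 1 \<longrightarrow> bounded_clinear (K z \<zeta>)) \<and>
    (\<forall>\<zeta> y. norm \<zeta> < 1 \<longrightarrow>
      (\<lambda>z. if norm z < 1 then K z \<zeta> y else 0) \<in> H \<and>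
      (\<forall>f\<in>H. bergman_inner n f (\<lambda>z. if norm z < 1 then K z \<zeta> y else 0) = cinner (f \<zeta>) y))"

end

theory Submission
  imports Defs
begin

text \<open>
  Write \<open>G\<close> for the Gramian \<open>gramian n k C A\<close> and \<open>V x\<close> for the shifted output
  \<open>z ^ k C R(z A) x\<close> of the state \<open>x\<close>, where \<open>R\<close> is the resolvent series. The Taylor
  coefficient of \<open>V x\<close> at \<open>j + k\<close> is a binomial weight times \<open>C A ^ j x\<close>, and the Bergman
  weight is the reciprocal of the same binomial weight, so that \<open>\<langle>V x, V y\<rangle> = \<langle>G x, y\<rangle>\<close>
  (\<open>bergman_inner_shifted_output\<close>). Once \<open>G\<close> is bounded and coercive, \<open>V\<close> is an
  isomorphism onto its range, which is therefore complete. A vector \<open>u\<close> with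
  \<open>G u = conj \<zeta> ^ k R(\<zeta> A)* C* y\<close> then satisfies
  \<open>\<langle>V x, V u\<rangle> = \<langle>x, G u\<rangle> = \<langle>\<zeta> ^ k C R(\<zeta> A) x, y\<rangle> = \<langle>(V x) \<zeta>, y\<rangle>\<close>,
  so \<open>V u\<close> is the kernel function (\<open>kernel_state_reproduces\<close>).

  The analytic work is to justify these manipulations from exact observability.

  \<^item> The operator \<open>G\<^sub>0 = gramian n 0 C A\<close> is positive and bounded below, hence coercive: its
    quadratic form, the energy \<open>\<Sum>j. binom_weight n j * (norm (C (A ^^ j x)))\<^sup>2\<close>, is
    equivalent to the squared norm (\<open>energy0_bounds\<close>).

  \<^item> The energy cannot grow along the orbit of \<open>A\<close>, because the weights increase with \<open>j\<close>.
    So \<open>A\<close> is power bounded (\<open>power_bounded\<close>), and as the weights grow only polynomially,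
    the resolvent series converges for all \<open>norm z < 1\<close>.

  \<^item> The weight at \<open>j + k\<close> lies between the weight at \<open>j\<close> and a constant multiple of it, so
    the energies for all \<open>k\<close> are equivalent; a Cauchy--Schwarz estimate turns convergence of
    these scalar series into strong convergence of the Gramian (\<open>gramian_partial_sum_le\<close>).

  Adjoints and the inverse of \<open>G\<close> both come from a minimisation argument for coercive
  symmetric forms (\<open>coercive_form_represents\<close>).
\<close>

section \<open>Elementary Hilbert space geometry\<close>

lemma cinner_add_right: "cinner x (y + z) = cinner x y + cinner x z"
  by (subst (1 2 3) cinner_commute) (simp add: cinner_add_left)

lemma cinner_scaleC_right: "cinner x (c *\<^sub>C y) = cnj c * cinner x y"
  by (subst (1 2) cinner_commute) (simp add: cinner_scaleC_left)

lemma cinner_scaleR_left: "cinner (r *\<^sub>R x) y = r *\<^sub>R cinner x y"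
  by (metis cinner_scaleC_left scaleC_of_real scaleR_conv_of_real)

lemma cinner_scaleR_right: "cinner x (r *\<^sub>R y) = r *\<^sub>R cinner x y"
  by (metis cinner_scaleC_right complex_cnj_complex_of_real scaleC_of_real scaleR_conv_of_real)

lemma cnj_cinner: "cnj (cinner x y) = cinner y x"
  by (rule cinner_commute[symmetric])

lemma Re_cinner_self: "Re (cinner x x) = (norm x)\<^sup>2"
  by (simp add: cinner_self)

lemma Re_cinner_commute: "Re (cinner x y) = Re (cinner y x)"
  by (subst cinner_commute) simp

lemma norm_scaleC: "norm (c *\<^sub>C x) = norm c * norm x"
proof -
  have "complex_of_real ((norm (c *\<^sub>C x))\<^sup>2) = c * cnj c * complex_of_real ((norm x)\<^sup>2)"
    by (metis cinner_scaleC_left cinner_scaleC_right cinner_self mult.assoc)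
  also have "\<dots> = complex_of_real ((norm c * norm x)\<^sup>2)"
    by (simp add: complex_norm_square power_mult_distrib flip: of_real_power)
  finally have "(norm (c *\<^sub>C x))\<^sup>2 = (norm c * norm x)\<^sup>2"
    using of_real_eq_iff by blast
  then show ?thesis
    by (simp add: power2_eq_iff_nonneg)
qed

lemma norm_cinner_le: "norm (cinner x y) \<le> norm x * norm y"
proof (cases "y = 0")
  case True
  have "cinner x 0 = 0"
    using cinner_add_right[of x 0 0] by simp
  with True show ?thesis by simp
next
  case False
  define a where "a = cinner x y"
  define r where "r = (norm y)\<^sup>2"
  have r: "r > 0" using False by (simp add: r_def)
  (* The residual of the orthogonal projection onto y, scaled to avoid division. *)
  define u where "u = r *\<^sub>R x + (- a) *\<^sub>C y"
  have yx: "cinner y x = cnj a"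
    unfolding a_def by (rule cinner_commute)
  have "cinner u u = of_real (r * r) * of_real ((norm x)\<^sup>2) - of_real r * (a * cnj a)"
    unfolding u_def
    by (simp add: cinner_add_left cinner_add_right cinner_scaleC_left cinner_scaleC_right
        cinner_scaleR_left cinner_scaleR_right yx a_def[symmetric] cinner_self[of x]
        cinner_self[of y] r_def[symmetric] scaleR_conv_of_real algebra_simps del: of_real_power)
  also have "\<dots> = of_real (r * (r * (norm x)\<^sup>2 - (norm a)\<^sup>2))"
    by (simp add: complex_norm_square algebra_simps flip: of_real_power)
  finally have "(norm u)\<^sup>2 = r * (r * (norm x)\<^sup>2 - (norm a)\<^sup>2)"
    by (metis cinner_self of_real_eq_iff)
  then have "0 \<le> r * (r * (norm x)\<^sup>2 - (norm a)\<^sup>2)"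
    by (metis zero_le_power2)
  then have "(norm a)\<^sup>2 \<le> (norm x * norm y)\<^sup>2"
    using r by (simp add: zero_le_mult_iff r_def power_mult_distrib mult.commute)
  then show ?thesis
    unfolding a_def by (rule power2_le_imp_le) simp
qed

interpretation cinner: bounded_bilinear "cinner :: 'a::complex_hilbert \<Rightarrow> 'a \<Rightarrow> complex"
proof
  show "\<exists>K. \<forall>a b. norm (cinner (a::'a) b) \<le> norm a * norm b * K"
    by (rule exI[of _ 1]) (simp add: norm_cinner_le)
qed (simp_all add: cinner_add_left cinner_add_right cinner_scaleR_left cinner_scaleR_right)

interpretation scaleC: bounded_bilinear "scaleC :: complex \<Rightarrow> 'a::complex_hilbert \<Rightarrow> 'a"
proof
  fix r :: real and c :: complex and x :: 'a
  show "(r *\<^sub>R c) *\<^sub>C x = r *\<^sub>R c *\<^sub>C x"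
    by (metis scaleC_of_real scaleC_scaleC scaleR_conv_of_real)
  show "c *\<^sub>C r *\<^sub>R x = r *\<^sub>R c *\<^sub>C x"
    by (metis mult.commute scaleC_of_real scaleC_scaleC)
  show "\<exists>K. \<forall>a b. norm (a *\<^sub>C (b::'a)) \<le> norm a * norm b * K"
    by (rule exI[of _ 1]) (simp add: norm_scaleC)
qed (simp_all add: scaleC_add_left scaleC_add_right)

lemma one_scaleC [simp]: "1 *\<^sub>C x = x"
  using scaleC_of_real[of 1 x] by simp

lemma Re_cinner_le: "Re (cinner x y) \<le> norm x * norm y"
  using complex_Re_le_cmod norm_cinner_le order_trans by blast

lemma eq_if_Re_cinner_eq:
  assumes "\<And>v. Re (cinner x v) = Re (cinner y v)"
  shows "x = y"
proof -
  have "Re (cinner (x - y) (x - y)) = 0"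
    using assms by (simp add: cinner.diff_left)
  then show ?thesis by (simp add: Re_cinner_self)
qed

lemma eq_if_cinner_eq: "(\<And>v. cinner x v = cinner y v) \<Longrightarrow> x = y"
  by (rule eq_if_Re_cinner_eq) simp

lemma eq_if_cinner_eq_right: "(\<And>v. cinner v x = cinner v y) \<Longrightarrow> x = y"
  by (rule eq_if_cinner_eq) (subst (1 2) cinner_commute, simp)

lemma bounded_clinearI:
  assumes "\<And>x y. T (x + y) = T x + T y"
    and "\<And>c x. T (c *\<^sub>C x) = c *\<^sub>C T x"
    and "\<And>x. norm (T x) \<le> norm x * K"
  shows "bounded_clinear T"
  unfolding bounded_clinear_def
proof (intro conjI allI)
  show "bounded_linear T"
    by (rule bounded_linear_intro[where K = K])
      (use assms in \<open>simp_all flip: scaleC_of_real\<close>)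
qed (rule assms)

lemma bounded_clinear_bounded_linear: "bounded_clinear T \<Longrightarrow> bounded_linear T"
  and bounded_clinear_scaleC: "bounded_clinear T \<Longrightarrow> T (c *\<^sub>C x) = c *\<^sub>C T x"
  by (auto simp: bounded_clinear_def)

lemma bounded_clinear_compose:
  assumes "bounded_clinear S" "bounded_clinear T"
  shows "bounded_clinear (\<lambda>x. S (T x))"
  using assms by (simp add: bounded_clinear_def bounded_linear_compose)

lemma bounded_clinear_scaled:
  assumes "bounded_clinear T"
  shows "bounded_clinear (\<lambda>x. c *\<^sub>C T x)"
  using assms
  by (simp add: bounded_clinear_def bounded_linear_compose[OF scaleC.bounded_linear_right]
      scaleC_scaleC mult.commute)

section \<open>Coercive forms, adjoints and inverses\<close>

text \<open>
  The functional \<open>v \<mapsto> b v v - 2 f v\<close> is bounded below, the parallelogram law makes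
  every minimising sequence Cauchy, and at the minimiser the first variation \<open>b x v - f v\<close>
  vanishes in every direction. This single argument yields both the Riesz representation
  theorem (\<open>b\<close> the inner product) and surjectivity of coercive symmetric operators.
\<close>

lemma coercive_form_represents:
  fixes b :: "'a::banach \<Rightarrow> 'a \<Rightarrow> real"
  assumes b: "bounded_bilinear b" and sym: "\<And>x y. b x y = b y x"
    and e: "\<epsilon> > 0" and coer: "\<And>x. \<epsilon> * (norm x)\<^sup>2 \<le> b x x"
    and f: "bounded_linear f"
  shows "\<exists>x. \<forall>v. b x v = f v"
proof -
  interpret b: bounded_bilinear b by (rule b)
  interpret f: bounded_linear f by (rule f)
  define J where "J x = b x x - 2 * f x" for x
  obtain K where K: "\<And>x. \<bar>f x\<bar> \<le> norm x * K"
    using f.bounded by auto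
  have lower: "- (K\<^sup>2 / \<epsilon>) \<le> J x" for x
  proof -
    have "0 \<le> (\<epsilon> * norm x - K)\<^sup>2 / \<epsilon>" using e by simp
    also have "\<dots> = \<epsilon> * (norm x)\<^sup>2 - 2 * (norm x * K) + K\<^sup>2 / \<epsilon>"
      using e by (simp add: power2_eq_square field_simps)
    also have "\<dots> \<le> J x + K\<^sup>2 / \<epsilon>"
      using coer[of x] K[of x] unfolding J_def by linarith
    finally show ?thesis by simp
  qed
  define m where "m = Inf (range J)"
  have bdd: "bdd_below (range J)" using lower by (rule bdd_belowI2)
  have m_le: "m \<le> J x" for x unfolding m_def by (rule cInf_lower[OF _ bdd]) simp
  have "\<exists>x. J x < m + 1 / real (Suc i)" for i
  proof -
    have "Inf (range J) < m + 1 / real (Suc i)" by (simp add: m_def)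
    then show ?thesis using cInf_lessD[of "range J"] by auto
  qed
  then obtain X where X: "\<And>i. J (X i) < m + 1 / real (Suc i)" by metis
  have par: "\<epsilon> * (norm (x - y))\<^sup>2 \<le> 2 * J x + 2 * J y - 4 * m" for x y
  proof -
    define h where "h = (1/2) *\<^sub>R (x + y)"
    have "b (x - y) (x - y) = 2 * J x + 2 * J y - 4 * J h"
      unfolding J_def h_def
      by (simp add: b.diff_left b.diff_right b.add_left b.add_right b.scaleR_left b.scaleR_right
          f.add f.scaleR sym[of y x] algebra_simps)
    then show ?thesis using coer[of "x - y"] m_le[of h] by (simp add: algebra_simps)
  qed
  have "Cauchy X"
  proof (rule metric_CauchyI)
    fix e :: real assume "e > 0"
    then have "\<epsilon> * e\<^sup>2 / 4 > 0" using \<open>\<epsilon> > 0\<close> by simp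
    then obtain N where N: "1 / real (Suc N) < \<epsilon> * e\<^sup>2 / 4"
      using nat_approx_posE by blast
    have "dist (X i) (X j) < e" if "i \<ge> N" "j \<ge> N" for i j
    proof -
      have le: "J (X l) - m < \<epsilon> * e\<^sup>2 / 4" if "l \<ge> N" for l
      proof -
        have "1 / real (Suc l) \<le> 1 / real (Suc N)" using that by (simp add: frac_le)
        then show ?thesis using X[of l] N by linarith
      qed
      have "\<epsilon> * (norm (X i - X j))\<^sup>2 < \<epsilon> * e\<^sup>2"
        using par[of "X i" "X j"] le[OF that(1)] le[OF that(2)] by linarith
      then show ?thesis
        using \<open>\<epsilon> > 0\<close> \<open>e > 0\<close> by (auto simp: dist_norm intro: power2_less_imp_less)
    qed
    then show "\<exists>M. \<forall>i\<ge>M. \<forall>j\<ge>M. dist (X i) (X j) < e" by blast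
  qed
  then obtain x where x: "X \<longlonglongrightarrow> x" using Cauchy_convergent convergent_def by blast
  have "(\<lambda>i. J (X i)) \<longlonglongrightarrow> J x"
    unfolding J_def by (intro tendsto_intros b.tendsto f.tendsto x)
  moreover have "(\<lambda>i. m + 1 / real (Suc i)) \<longlonglongrightarrow> m + 0"
    by (intro tendsto_intros LIMSEQ_Suc[OF lim_1_over_n])
  ultimately have "J x \<le> m + 0"
    by (rule LIMSEQ_le) (use X less_imp_le in blast)
  then have min: "J x \<le> J y" for y using m_le[of y] by simp
  have "b x v = f v" for v
  proof -
    define d where "d = b x v - f v"
    define q where "q = b v v"
    have q: "q \<ge> 0"
      unfolding q_def using coer[of v] e by (meson mult_nonneg_nonneg less_imp_le order_trans zero_le_power2)
    (* The minimising step would be - d / q, but q may vanish. *)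
    define t where "t = - d / (q + 1)"
    have "J (x + t *\<^sub>R v) - J x = t\<^sup>2 * q + 2 * t * d"
      unfolding J_def d_def q_def
      by (simp add: b.add_left b.add_right b.scaleR_left b.scaleR_right f.add f.scaleR
          sym[of v x] power2_eq_square algebra_simps)
    then have "0 \<le> t\<^sup>2 * q + 2 * t * d" using min[of "x + t *\<^sub>R v"] by simp
    also have "\<dots> = - (d\<^sup>2 * (q + 2) / (q + 1)\<^sup>2)"
      using q unfolding t_def by (simp add: field_simps power2_eq_square add_nonneg_eq_0_iff)
    finally have "d\<^sup>2 * (q + 2) / (q + 1)\<^sup>2 \<le> 0" by simp
    then have "d = 0" using q by (simp add: divide_le_0_iff mult_le_0_iff power2_eq_square)
        (smt (verit) mult_pos_pos zero_less_mult_iff)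
    then show ?thesis by (simp add: d_def)
  qed
  then show ?thesis by blast
qed

lemma bounded_bilinear_Re_cinner:
  assumes "bounded_linear G"
  shows "bounded_bilinear (\<lambda>x y. Re (cinner (G x) y))"
proof -
  have "bounded_bilinear (\<lambda>x y. cinner (G x) y)"
    by (rule cinner.comp1[OF assms])
  then interpret B: bounded_bilinear "\<lambda>x y. cinner (G x) y" .
  obtain K where K: "\<And>x y. norm (cinner (G x) y) \<le> norm x * norm y * K"
    using B.bounded by blast
  show ?thesis
  proof
    show "\<exists>K. \<forall>x y. norm (Re (cinner (G x) y)) \<le> norm x * norm y * K"
      using K abs_Re_le_cmod order_trans real_norm_def by metis
  qed (simp_all add: B.add_left B.add_right B.scaleR_left B.scaleR_right)
qed

lemma riesz_representation:
  fixes \<phi> :: "'x::complex_hilbert \<Rightarrow> complex"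
  assumes "bounded_clinear \<phi>"
  shows "\<exists>u. \<forall>v. \<phi> v = cinner v u"
proof -
  have "bounded_bilinear (\<lambda>x y::'x. Re (cinner x y))"
    by (rule bounded_bilinear_Re_cinner[OF bounded_linear_ident])
  then have "\<exists>u. \<forall>v. Re (cinner u v) = Re (\<phi> v)"
  proof (rule coercive_form_represents[where \<epsilon> = 1])
    show "bounded_linear (\<lambda>v. Re (\<phi> v))"
      by (rule bounded_linear_compose[OF bounded_linear_Re bounded_clinear_bounded_linear[OF assms]])
  qed (simp_all only: Re_cinner_self Re_cinner_commute mult_1 order_refl zero_less_one)
  then obtain u where "\<forall>v. Re (cinner u v) = Re (\<phi> v)" by blast
  then have u: "Re (\<phi> v) = Re (cinner v u)" for v
    using Re_cinner_commute[of v u] by simp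
  (* Complex linearity recovers the imaginary part from the real part at i v. *)
  have "\<phi> v = cinner v u" for v
  proof (rule complex_eqI)
    have "\<phi> (\<i> *\<^sub>C v) = \<i> * \<phi> v"
      by (simp add: bounded_clinear_scaleC[OF assms] scaleC_complex_def)
    then show "Im (\<phi> v) = Im (cinner v u)"
      using u[of "\<i> *\<^sub>C v"] by (simp add: cinner_scaleC_left)
  qed (rule u)
  then show ?thesis by blast
qed

lemma cinner_cadjoint:
  assumes T: "bounded_clinear T"
  shows "cinner (T x) y = cinner x (cadjoint T y)"
proof -
  have "\<exists>u. \<forall>x. cinner (T x) y = cinner x u" for y
  proof -
    have "bounded_clinear (\<lambda>x. cinner (T x) y)"
      unfolding bounded_clinear_def
    proof (intro conjI allI)
      show "bounded_linear (\<lambda>x. cinner (T x) y)"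
        by (rule bounded_linear_compose[OF cinner.bounded_linear_left
              bounded_clinear_bounded_linear[OF T]])
      show "cinner (T (c *\<^sub>C x)) y = c *\<^sub>C cinner (T x) y" for c x
        unfolding bounded_clinear_scaleC[OF T] cinner_scaleC_left scaleC_complex_def ..
    qed
    then show ?thesis by (rule riesz_representation)
  qed
  then have "\<exists>U. \<forall>y x. cinner (T x) y = cinner x (U y)"
    by (intro choice allI)
  then obtain U where U: "\<And>x y. cinner (T x) y = cinner x (U y)" by blast
  have "cadjoint T = U"
    unfolding cadjoint_def
  proof (rule the_equality)
    fix V assume V: "\<forall>x y. cinner (T x) y = cinner x (V y)"
    show "V = U" by (rule ext, rule eq_if_cinner_eq_right) (simp add: U[symmetric] V)
  qed (simp add: U)
  then show ?thesis by (simp add: U)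
qed

lemma bounded_clinear_cadjoint:
  assumes T: "bounded_clinear T"
  shows "bounded_clinear (cadjoint T)"
proof -
  note adj = cinner_cadjoint[OF T, symmetric]
  obtain K where K: "\<And>x. norm (T x) \<le> norm x * K" "K \<ge> 0"
    using bounded_linear.nonneg_bounded[OF bounded_clinear_bounded_linear[OF T]] by blast
  show ?thesis
  proof (rule bounded_clinearI[where K = K])
    show "cadjoint T (x + y) = cadjoint T x + cadjoint T y" for x y
      by (rule eq_if_cinner_eq_right) (simp add: adj cinner.add_right)
    show "cadjoint T (c *\<^sub>C x) = c *\<^sub>C cadjoint T x" for c x
      by (rule eq_if_cinner_eq_right) (simp add: adj cinner_scaleC_right)
    show "norm (cadjoint T y) \<le> norm y * K" for y
    proof -
      let ?u = "cadjoint T y"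
      have "norm ?u * norm ?u = Re (cinner (T ?u) y)"
        by (simp add: cinner_cadjoint[OF T] Re_cinner_self power2_eq_square)
      also have "\<dots> \<le> norm (T ?u) * norm y" by (rule Re_cinner_le)
      also have "\<dots> \<le> norm ?u * K * norm y" by (intro mult_right_mono K) simp
      finally have "norm ?u * norm ?u \<le> norm ?u * (norm y * K)" by (simp add: ac_simps)
      then show ?thesis
        using K(2) by (cases "norm ?u = 0") (auto simp: mult_le_cancel_left)
    qed
  qed
qed

lemma coercive_symmetric_inverse:
  fixes G :: "'x::complex_hilbert \<Rightarrow> 'x"
  assumes G: "bounded_clinear G" and sym: "\<And>x y. cinner (G x) y = cinner x (G y)"
    and d: "\<delta> > 0" and coer: "\<And>x. \<delta> * (norm x)\<^sup>2 \<le> Re (cinner (G x) x)"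
  shows "G (inv G y) = y" and "bounded_clinear (inv G)"
proof -
  interpret G: bounded_linear G by (rule bounded_clinear_bounded_linear[OF G])
  have "\<exists>x. y = G x" for y
  proof -
    have "\<exists>x. \<forall>v. Re (cinner (G x) v) = Re (cinner y v)"
    proof (rule coercive_form_represents[OF bounded_bilinear_Re_cinner[OF G.bounded_linear_axioms] _ d coer])
      show "Re (cinner (G x) y) = Re (cinner (G y) x)" for x y
        using sym[of x y] Re_cinner_commute[of x "G y"] by simp
      show "bounded_linear (\<lambda>v. Re (cinner y v))"
        by (rule bounded_linear_compose[OF bounded_linear_Re cinner.bounded_linear_right])
    qed
    then obtain x where "G x = y" using eq_if_Re_cinner_eq by blast
    then show ?thesis by blast
  qed
  then have "surj G" by (simp add: surj_def)
  then show Ginv: "G (inv G y) = y" for y by (rule surj_f_inv_f)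
  have "inj G"
  proof (rule injI)
    fix x y assume "G x = G y"
    then have "\<delta> * (norm (x - y))\<^sup>2 \<le> 0" using coer[of "x - y"] by (simp add: G.diff cinner.zero_left)
    then show "x = y" using d by (simp add: mult_le_0_iff)
  qed
  then have invI: "inv G y = x" if "G x = y" for x y
    using that by (metis inv_f_f)
  show "bounded_clinear (inv G)"
  proof (rule bounded_clinearI[where K = "1 / \<delta>"])
    show "inv G (x + y) = inv G x + inv G y" for x y
      by (rule invI) (simp add: G.add Ginv)
    show "inv G (c *\<^sub>C x) = c *\<^sub>C inv G x" for c x
      by (rule invI) (simp add: bounded_clinear_scaleC[OF G] Ginv)
    show "norm (inv G y) \<le> norm y * (1 / \<delta>)" for y
    proof -
      let ?u = "inv G y"
      have "norm ?u * (\<delta> * norm ?u) \<le> Re (cinner y ?u)"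
        using coer[of ?u] by (simp add: Ginv power2_eq_square ac_simps)
      also have "\<dots> \<le> norm ?u * norm y" using Re_cinner_le[of y ?u] by (simp add: mult.commute)
      finally have "norm ?u * (\<delta> * norm ?u) \<le> norm ?u * norm y" .
      then have "\<delta> * norm ?u \<le> norm y"
        by (cases "norm ?u = 0") (auto simp: mult_le_cancel_left)
      then show ?thesis using d by (simp add: field_simps)
    qed
  qed
qed

text \<open>
  This is Cauchy--Schwarz for the semi-inner product \<open>cinner (G x) y\<close> at \<open>x\<close> and \<open>G x\<close>,
  read off from the vector \<open>x - t *\<^sub>R G x\<close>. It makes a positive operator that is
  bounded below coercive.
\<close>

lemma positive_operator_norm_le:
  assumes G: "bounded_clinear G" and sym: "\<And>x y. cinner (G x) y = cinner x (G y)"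
    and pos: "\<And>x. 0 \<le> Re (cinner (G x) x)"
    and M: "\<And>x. norm (G x) \<le> norm x * M" "M > 0"
  shows "(norm (G x))\<^sup>2 \<le> M * Re (cinner (G x) x)"
proof -
  interpret G: bounded_linear G by (rule bounded_clinear_bounded_linear[OF G])
  define t where "t = 1 / M"
  let ?g = "G x"
  have "Re (cinner (G ?g) ?g) \<le> norm (G ?g) * norm ?g" by (rule Re_cinner_le)
  also have "\<dots> \<le> norm ?g * M * norm ?g" by (intro mult_right_mono M) simp
  finally have gg: "Re (cinner (G ?g) ?g) \<le> M * (norm ?g)\<^sup>2"
    by (simp add: power2_eq_square ac_simps)
  have "0 \<le> Re (cinner (G (x - t *\<^sub>R ?g)) (x - t *\<^sub>R ?g))" by (rule pos)
  also have "\<dots> = Re (cinner ?g x) - 2 * t * (norm ?g)\<^sup>2 + t\<^sup>2 * Re (cinner (G ?g) ?g)"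
    by (simp add: G.diff G.scaleR cinner.diff_left cinner.diff_right cinner.scaleR_left
        cinner.scaleR_right sym[of ?g x] Re_cinner_self power2_eq_square algebra_simps)
  also have "\<dots> \<le> Re (cinner ?g x) - 2 * t * (norm ?g)\<^sup>2 + t\<^sup>2 * (M * (norm ?g)\<^sup>2)"
    by (intro add_left_mono mult_left_mono gg) simp
  also have "\<dots> = Re (cinner ?g x) - (norm ?g)\<^sup>2 / M"
    using M(2) by (simp add: t_def power2_eq_square field_simps)
  finally show ?thesis using M(2) by (simp add: field_simps)
qed

section \<open>Binomial weights\<close>

definition binom_weight :: "nat \<Rightarrow> nat \<Rightarrow> real"
  where "binom_weight n j = real ((n + j - 1) choose j)"

lemma bergman_weight_eq: "bergman_weight n j = 1 / binom_weight n j"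
  by (simp add: bergman_weight_def binom_weight_def)

lemma binom_weight_Suc: "binom_weight (Suc m) j = real ((m + j) choose m)"
  unfolding binom_weight_def by (simp add: binomial_symmetric[of j "m + j"])

lemma binom_weight_pos: "n \<ge> 1 \<Longrightarrow> binom_weight n j > 0"
  by (cases n) (simp_all add: binom_weight_Suc)

lemma binom_weight_mono:
  assumes "n \<ge> 1" "i \<le> j"
  shows "binom_weight n i \<le> binom_weight n j"
  using assms by (cases n) (simp_all add: binom_weight_Suc binomial_right_mono)

text \<open>
  Up to the factor \<open>m!\<close>, \<open>binom_weight (Suc m) j\<close> is the product of \<open>j + 1, \<dots>, j + m\<close>,
  and \<open>i (j + k + i) \<le> (j + i) (k + i)\<close> for each factor.
\<close>

lemma binom_weight_submult:
  assumes "n \<ge> 1"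
  shows "binom_weight n (j + k) \<le> binom_weight n j * binom_weight n k"
proof -
  have "real ((m + (j + k)) choose m) \<le> real ((m + j) choose m) * real ((m + k) choose m)" for m
  proof (induction m)
    case 0
    show ?case by simp
  next
    case (Suc m)
    have step: "real ((Suc m + l) choose Suc m) = (1 + l / Suc m) * real ((m + l) choose m)"
      for l :: nat
    proof -
      have "real (Suc m) * real (Suc (m + l) choose Suc m) = real (Suc (m + l)) * real ((m + l) choose m)"
        using Suc_times_binomial_eq[of "m + l" m] by (metis mult.commute of_nat_mult)
      then show ?thesis by (simp add: field_simps)
    qed
    have "1 + real (j + k) / Suc m \<le> (1 + j / Suc m) * (1 + k / Suc m)"
      by (simp add: algebra_simps add_divide_distrib)
    then have "(1 + real (j + k) / Suc m) * real ((m + (j + k)) choose m) \<le>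
        ((1 + j / Suc m) * (1 + k / Suc m)) * (real ((m + j) choose m) * real ((m + k) choose m))"
      by (intro mult_mono Suc.IH) simp_all
    then show ?case unfolding step by (simp only: ac_simps)
  qed
  then show ?thesis
    using assms by (cases n) (simp_all add: binom_weight_Suc)
qed

text \<open>Multiplying by the geometric series turns the weights for \<open>n\<close> into those for \<open>n + 1\<close>.\<close>

lemma summable_binom_weight_power:
  assumes "n \<ge> 1" and r: "0 \<le> r" "r < 1"
  shows "summable (\<lambda>j. binom_weight n j * r ^ j)"
proof -
  have "summable (\<lambda>j. binom_weight (Suc m) j * r ^ j)" for m
  proof (induction m)
    case 0
    show ?case using r by (simp add: binom_weight_Suc summable_geometric)
  next
    case (Suc m)
    have "summable (\<lambda>j. \<Sum>i\<le>j. (binom_weight (Suc m) i * r ^ i) * r ^ (j - i))"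
      using Suc r by (intro summable_Cauchy_product)
        (simp_all add: binom_weight_def summable_geometric)
    also have "(\<lambda>j. \<Sum>i\<le>j. (binom_weight (Suc m) i * r ^ i) * r ^ (j - i)) =
        (\<lambda>j. binom_weight (Suc (Suc m)) j * r ^ j)"
    proof
      fix j
      have "(\<Sum>i\<le>j. (binom_weight (Suc m) i * r ^ i) * r ^ (j - i)) =
          (\<Sum>i\<le>j. binom_weight (Suc m) i) * r ^ j"
        unfolding sum_distrib_right
        by (intro sum.cong refl) (simp add: mult.assoc flip: power_add)
      also have "(\<Sum>i\<le>j. binom_weight (Suc m) i) = binom_weight (Suc (Suc m)) j"
        using sum_choose_lower[of m j] by (simp add: binom_weight_def flip: of_nat_sum)
      finally show "(\<Sum>i\<le>j. (binom_weight (Suc m) i * r ^ i) * r ^ (j - i)) =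
          binom_weight (Suc (Suc m)) j * r ^ j" .
    qed
    finally show ?case .
  qed
  then show ?thesis using assms(1) by (cases n) simp_all
qed

section \<open>Taylor coefficients and the Bergman inner product\<close>

text \<open>Pairing with a fixed vector reduces this to uniqueness for scalar power series.\<close>

lemma vector_powser_unique:
  fixes c d :: "nat \<Rightarrow> 'y::complex_hilbert"
  assumes c: "\<And>z. norm z < 1 \<Longrightarrow> (\<lambda>j. z ^ j *\<^sub>C c j) sums f z"
    and d: "\<And>z. norm z < 1 \<Longrightarrow> (\<lambda>j. z ^ j *\<^sub>C d j) sums f z"
  shows "c = d"
proof (rule ext, rule eq_if_cinner_eq)
  fix j and y :: 'y
  define F where "F e = Abs_fps (\<lambda>j. cinner (e j) y)" for e :: "nat \<Rightarrow> 'y"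
  have sums: "(\<lambda>j. fps_nth (F e) j * z ^ j) sums cinner (f z) y"
    if "(\<lambda>j. z ^ j *\<^sub>C e j) sums f z" for e z
    using bounded_linear.sums[OF cinner.bounded_linear_left that, of y]
    by (simp add: F_def cinner_scaleC_left mult.commute)
  have radius: "fps_conv_radius (F e) > 0"
    if "(\<lambda>j. (1/2) ^ j *\<^sub>C e j) sums f (1/2)" for e
  proof -
    have "ereal (norm (1/2 :: complex)) \<le> fps_conv_radius (F e)"
      unfolding fps_conv_radius_def
      by (rule conv_radius_geI[OF sums_summable[OF sums[OF that]]])
    then show ?thesis by (rule less_le_trans[rotated]) simp
  qed
  have half: "norm (1/2 :: complex) < 1" by simp
  have "F c = F d"
  proof (rule eval_fps_eqD[OF radius[OF c[OF half]] radius[OF d[OF half]]])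
    have "eventually (\<lambda>z :: complex. z \<in> ball 0 1) (nhds 0)"
      by (intro eventually_nhds_in_open) auto
    then show "eventually (\<lambda>z. eval_fps (F c) z = eval_fps (F d) z) (nhds 0)"
    proof eventually_elim
      case (elim z)
      then have z: "norm z < 1" by simp
      show ?case
        unfolding eval_fps_def using sums[OF c[OF z]] sums[OF d[OF z]] by (simp add: sums_iff)
    qed
  qed
  then show "cinner (c j) y = cinner (d j) y"
    by (metis F_def fps_nth_Abs_fps)
qed

lemma taylor_coeff_eq:
  assumes "\<And>z. norm z < 1 \<Longrightarrow> (\<lambda>j. z ^ j *\<^sub>C c j) sums f z"
  shows "taylor_coeff f = c"
  unfolding taylor_coeff_def
proof (rule the_equality)
  fix d assume "\<forall>z. norm z < 1 \<longrightarrow> (\<lambda>j. z ^ j *\<^sub>C d j) sums f z"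
  then show "d = c" using assms by (intro vector_powser_unique[of d f c]) auto
qed (use assms in blast)

lemma funpow_bergman_shift: "(bergman_shift ^^ k) f = (\<lambda>z. z ^ k *\<^sub>C f z)"
  by (induction k) (simp_all add: bergman_shift_def fun_eq_iff scaleC_scaleC)

section \<open>Observability Gramians\<close>

lemma cinner_gramian_term:
  assumes "bounded_clinear A" "bounded_clinear C"
  shows "cinner (gramian_term n k C A j x) y =
    of_real (binom_weight n (j + k)) * cinner (C ((A ^^ j) x)) (C ((A ^^ j) y))"
proof -
  have swap: "cinner (cadjoint T u) v = cinner u (T v)" if "bounded_clinear T"
    for T :: "'c::complex_hilbert \<Rightarrow> 'd::complex_hilbert" and u v
    using cinner_cadjoint[OF that, of v u] by (subst (1 2) cinner_commute) simp
  have "cinner ((cadjoint A ^^ j) u) y = cinner u ((A ^^ j) y)" for u y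
    by (induction j arbitrary: y) (simp_all add: swap[OF assms(1)] funpow_swap1[of A])
  then show ?thesis
    by (simp add: gramian_term_def cinner_scaleR_left scaleR_conv_of_real swap[OF assms(2)]
        binom_weight_def add.assoc)
qed

locale exactly_observable_pair =
  fixes n :: nat and C :: "'x::complex_hilbert \<Rightarrow> 'y::complex_hilbert" and A :: "'x \<Rightarrow> 'x"
  assumes n: "n \<ge> 1" and A: "bounded_clinear A" and C: "bounded_clinear C"
    and observable: "exactly_observable n C A"
begin

sublocale A: bounded_linear A by (rule bounded_clinear_bounded_linear[OF A])
sublocale C: bounded_linear C by (rule bounded_clinear_bounded_linear[OF C])

abbreviation out :: "nat \<Rightarrow> 'x \<Rightarrow> 'y" where "out j x \<equiv> C ((A ^^ j) x)"

definition energy :: "nat \<Rightarrow> nat \<Rightarrow> 'x \<Rightarrow> real"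
  where "energy k j x = binom_weight n (j + k) * (norm (out j x))\<^sup>2"

lemma power_A_add: "(A ^^ j) (x + y) = (A ^^ j) x + (A ^^ j) y"
  by (induction j) (simp_all add: A.add)

lemma power_A_scaleC: "(A ^^ j) (c *\<^sub>C x) = c *\<^sub>C (A ^^ j) x"
  by (induction j) (simp_all add: bounded_clinear_scaleC[OF A])

lemma weight_nonneg: "0 \<le> binom_weight n j"
  by (rule less_imp_le[OF binom_weight_pos[OF n]])

lemma energy_nonneg: "0 \<le> energy k j x"
  by (simp add: energy_def weight_nonneg)

lemma cinner_gramian_sums:
  assumes "summable (\<lambda>j. gramian_term n k C A j x)"
  shows "(\<lambda>j. of_real (binom_weight n (j + k)) * cinner (out j x) (out j y))
    sums cinner (gramian n k C A x) y"
  using bounded_linear.sums[OF cinner.bounded_linear_left summable_sums[OF assms], of y]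
  by (simp add: cinner_gramian_term[OF A C] gramian_def)

lemma gramian_symmetric_if_summable:
  assumes "\<And>x. summable (\<lambda>j. gramian_term n k C A j x)"
  shows "cinner (gramian n k C A x) y = cinner x (gramian n k C A y)"
proof -
  have "(\<lambda>j. cnj (of_real (binom_weight n (j + k)) * cinner (out j y) (out j x)))
      sums cnj (cinner (gramian n k C A y) x)"
    by (subst sums_cnj) (rule cinner_gramian_sums[OF assms])
  then have "(\<lambda>j. of_real (binom_weight n (j + k)) * cinner (out j x) (out j y))
      sums cinner x (gramian n k C A y)"
    by (simp add: cnj_cinner)
  with cinner_gramian_sums[OF assms, of x y] show ?thesis by (rule sums_unique2)
qed

lemma energy_sums_if_summable:
  assumes "summable (\<lambda>j. gramian_term n k C A j x)"
  shows "(\<lambda>j. energy k j x) sums Re (cinner (gramian n k C A x) x)"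
  using bounded_linear.sums[OF bounded_linear_Re cinner_gramian_sums[OF assms, of x]]
  by (simp add: cinner_self energy_def)

lemma gramian0_summable: "summable (\<lambda>j. gramian_term n 0 C A j x)"
  and gramian0_bounded: "bounded_clinear (gramian n 0 C A)"
  using observable by (simp_all add: exactly_observable_def)

lemma energy0_sums: "(\<lambda>j. energy 0 j x) sums Re (cinner (gramian n 0 C A x) x)"
  by (rule energy_sums_if_summable[OF gramian0_summable])

lemma energy0_bounds:
  shows "\<exists>M>0. \<forall>x. (\<Sum>j. energy 0 j x) \<le> M * (norm x)\<^sup>2"
    and "\<exists>\<delta>>0. \<forall>x. \<delta> * (norm x)\<^sup>2 \<le> (\<Sum>j. energy 0 j x)"
proof -
  let ?G = "gramian n 0 C A"
  have sum_eq: "(\<Sum>j. energy 0 j x) = Re (cinner (?G x) x)" for x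
    using energy0_sums by (simp add: sums_iff)
  obtain M where M: "M > 0" "\<And>x. norm (?G x) \<le> norm x * M"
    using bounded_linear.pos_bounded[OF bounded_clinear_bounded_linear[OF gramian0_bounded]] by blast
  have "Re (cinner (?G x) x) \<le> M * (norm x)\<^sup>2" for x
  proof -
    have "Re (cinner (?G x) x) \<le> norm (?G x) * norm x" by (rule Re_cinner_le)
    also have "\<dots> \<le> norm x * M * norm x" by (intro mult_right_mono M) simp
    finally show ?thesis by (simp add: power2_eq_square ac_simps)
  qed
  then show "\<exists>M>0. \<forall>x. (\<Sum>j. energy 0 j x) \<le> M * (norm x)\<^sup>2"
    using M(1) by (auto simp: sum_eq)
  obtain e where e: "e > 0" "\<And>x. e * norm x \<le> norm (?G x)"
    using observable by (auto simp: exactly_observable_def bounded_below_def)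
  have "e\<^sup>2 / M * (norm x)\<^sup>2 \<le> Re (cinner (?G x) x)" for x
  proof -
    have "0 \<le> Re (cinner (?G y) y)" for y
      using suminf_nonneg[OF sums_summable[OF energy0_sums]] energy_nonneg by (simp add: sum_eq)
    then have "(norm (?G x))\<^sup>2 \<le> M * Re (cinner (?G x) x)"
      by (intro positive_operator_norm_le[OF gramian0_bounded] M
          gramian_symmetric_if_summable[OF gramian0_summable])
    moreover have "(e * norm x)\<^sup>2 \<le> (norm (?G x))\<^sup>2"
      using e by (intro power_mono) simp_all
    ultimately show ?thesis using M(1) by (simp add: field_simps power_mult_distrib)
  qed
  then show "\<exists>\<delta>>0. \<forall>x. \<delta> * (norm x)\<^sup>2 \<le> (\<Sum>j. energy 0 j x)"
    using e(1) M(1) by (intro exI[of _ "e\<^sup>2 / M"]) (simp add: sum_eq)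
qed

text \<open>
  The energy of \<open>A ^^ m x\<close> is the tail of the energy of \<open>x\<close> with smaller weights, since
  the weights increase; as the energy is equivalent to the squared norm, the powers of \<open>A\<close>
  are uniformly bounded. This is what makes the resolvent series converge on the whole disk.
\<close>

lemma power_bounded: "\<exists>B>0. \<forall>m x. norm ((A ^^ m) x) \<le> B * norm x"
proof -
  obtain M where M: "M > 0" "\<And>x. (\<Sum>j. energy 0 j x) \<le> M * (norm x)\<^sup>2"
    using energy0_bounds(1) by blast
  obtain \<delta> where \<delta>: "\<delta> > 0" "\<And>x. \<delta> * (norm x)\<^sup>2 \<le> (\<Sum>j. energy 0 j x)"
    using energy0_bounds(2) by blast
  have summable: "summable (\<lambda>j. energy 0 j x)" for x
    using energy0_sums sums_summable by blast
  have "norm ((A ^^ m) x) \<le> sqrt (M / \<delta>) * norm x" for m x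
  proof -
    have "energy 0 j ((A ^^ m) x) \<le> energy 0 (j + m) x" for j
      using binom_weight_mono[OF n, of j "j + m"]
      by (simp add: energy_def funpow_add mult_right_mono)
    then have "(\<Sum>j. energy 0 j ((A ^^ m) x)) \<le> (\<Sum>j. energy 0 (j + m) x)"
      by (intro suminf_le summable summable_ignore_initial_segment)
    also have "\<dots> \<le> (\<Sum>j. energy 0 j x)"
      using suminf_split_initial_segment[OF summable, of x m]
      by (simp add: sum_nonneg energy_nonneg)
    finally have "\<delta> * (norm ((A ^^ m) x))\<^sup>2 \<le> M * (norm x)\<^sup>2"
      using M(2)[of x] \<delta>(2)[of "(A ^^ m) x"] by linarith
    then have "(norm ((A ^^ m) x))\<^sup>2 \<le> (sqrt (M / \<delta>) * norm x)\<^sup>2"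
      using M(1) \<delta>(1) by (simp add: power_mult_distrib field_simps)
    then show ?thesis by (rule power2_le_imp_le) (use M \<delta> in simp)
  qed
  then show ?thesis using M(1) \<delta>(1) by (intro exI[of _ "sqrt (M / \<delta>)"]) simp
qed

lemma energy_summable: "summable (\<lambda>j. energy k j x)"
  and energy_lower: "(\<Sum>j. energy 0 j x) \<le> (\<Sum>j. energy k j x)"
  and energy_upper: "(\<Sum>j. energy k j x) \<le> binom_weight n k * (\<Sum>j. energy 0 j x)"
proof -
  have summable0: "summable (\<lambda>j. energy 0 j x)"
    using energy0_sums sums_summable by blast
  have le: "energy k j x \<le> binom_weight n k * energy 0 j x" for j
    using mult_right_mono[OF binom_weight_submult[OF n, of j k], of "(norm (out j x))\<^sup>2"]
    by (simp add: energy_def ac_simps)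
  show summable: "summable (\<lambda>j. energy k j x)"
    by (rule summable_comparison_test'[OF summable_mult[OF summable0]])
      (use le in \<open>simp add: energy_nonneg\<close>)
  show "(\<Sum>j. energy k j x) \<le> binom_weight n k * (\<Sum>j. energy 0 j x)"
    unfolding suminf_mult[OF summable0, symmetric]
    by (intro suminf_le summable summable_mult summable0 le)
  show "(\<Sum>j. energy 0 j x) \<le> (\<Sum>j. energy k j x)"
    by (intro suminf_le summable summable0)
      (simp add: energy_def mult_right_mono binom_weight_mono[OF n])
qed

lemma energy_bounded: "\<exists>M>0. \<forall>x. (\<Sum>j. energy k j x) \<le> M * (norm x)\<^sup>2"
proof -
  obtain M where M: "M > 0" "\<And>x. (\<Sum>j. energy 0 j x) \<le> M * (norm x)\<^sup>2"
    using energy0_bounds(1) by blast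
  have "(\<Sum>j. energy k j x) \<le> (binom_weight n k * M) * (norm x)\<^sup>2" for x
    using energy_upper[of k x] mult_left_mono[OF M(2)[of x] weight_nonneg[of k]]
    by (simp add: mult.assoc)
  then show ?thesis using M(1) binom_weight_pos[OF n, of k]
    by (intro exI[of _ "binom_weight n k * M"]) simp
qed

lemma energy_coercive: "\<exists>\<delta>>0. \<forall>x. \<delta> * (norm x)\<^sup>2 \<le> (\<Sum>j. energy k j x)"
  using energy0_bounds(2) energy_lower order_trans by meson

text \<open>
  Cauchy--Schwarz, applied to the partial sum \<open>s\<close> paired with itself, bounds \<open>(norm s)\<^sup>2\<close>
  by the geometric mean of the energies of \<open>x\<close> and of \<open>s\<close>, and the latter is at most \<open>M * (norm s)\<^sup>2\<close>. So the
  strong convergence of the Gramian is governed by scalar tails.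
\<close>

lemma gramian_partial_sum_le:
  assumes M: "M > 0" "\<And>x. (\<Sum>j. energy k j x) \<le> M * (norm x)\<^sup>2" and I: "finite I"
  shows "(norm (\<Sum>j\<in>I. gramian_term n k C A j x))\<^sup>2 \<le> M * (\<Sum>j\<in>I. energy k j x)"
proof -
  define s where "s = (\<Sum>j\<in>I. gramian_term n k C A j x)"
  define a where "a j y = sqrt (binom_weight n (j + k)) * norm (out j y)" for j y
  have a2: "(a j y)\<^sup>2 = energy k j y" for j y
    by (simp add: a_def energy_def power_mult_distrib weight_nonneg)
  have "(norm s)\<^sup>2 = (\<Sum>j\<in>I. Re (cinner (gramian_term n k C A j x) s))"
    unfolding Re_cinner_self[symmetric] by (subst s_def, subst cinner.sum_left) (simp add: Re_sum)
  also have "\<dots> \<le> (\<Sum>j\<in>I. a j x * a j s)"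
  proof (rule sum_mono)
    fix j
    have "a j x * a j s = binom_weight n (j + k) * (norm (out j x) * norm (out j s))"
      by (simp add: a_def weight_nonneg algebra_simps flip: real_sqrt_mult)
    then show "Re (cinner (gramian_term n k C A j x) s) \<le> a j x * a j s"
      by (simp add: cinner_gramian_term[OF A C] mult_left_mono weight_nonneg Re_cinner_le)
  qed
  finally have "((norm s)\<^sup>2)\<^sup>2 \<le> (\<Sum>j\<in>I. a j x * a j s)\<^sup>2"
    by (rule power_mono) simp
  also have "\<dots> \<le> (\<Sum>j\<in>I. energy k j x) * (\<Sum>j\<in>I. energy k j s)"
    using Cauchy_Schwarz_ineq_sum[of "\<lambda>j. a j x" "\<lambda>j. a j s" I] by (simp add: a2)
  also have "\<dots> \<le> (\<Sum>j\<in>I. energy k j x) * (M * (norm s)\<^sup>2)"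
    using sum_le_suminf[OF energy_summable I energy_nonneg, of k s] M(2)[of s]
    by (intro mult_left_mono) (auto intro: sum_nonneg energy_nonneg)
  finally have le: "(norm s)\<^sup>2 * (norm s)\<^sup>2 \<le> (norm s)\<^sup>2 * (M * (\<Sum>j\<in>I. energy k j x))"
    by (simp add: power2_eq_square ac_simps)
  show ?thesis
  proof (cases "s = 0")
    case True
    then show ?thesis using M(1) by (simp add: s_def sum_nonneg energy_nonneg)
  next
    case False
    then show ?thesis
      unfolding s_def[symmetric] by (intro mult_left_le_imp_le[OF le]) simp
  qed
qed

lemma gramian_summable: "summable (\<lambda>j. gramian_term n k C A j x)"
  unfolding summable_Cauchy
proof (intro allI impI)
  fix e :: real assume e: "e > 0"
  obtain M where M: "M > 0" "\<And>x. (\<Sum>j. energy k j x) \<le> M * (norm x)\<^sup>2"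
    using energy_bounded by blast
  have "e\<^sup>2 / M > 0" using e M(1) by simp
  then obtain N where N: "\<And>m p. m \<ge> N \<Longrightarrow> norm (\<Sum>j=m..<p. energy k j x) < e\<^sup>2 / M"
    using energy_summable[of k x] unfolding summable_Cauchy by blast
  have "norm (\<Sum>j=m..<p. gramian_term n k C A j x) < e" if "m \<ge> N" for m p
  proof -
    have "(norm (\<Sum>j=m..<p. gramian_term n k C A j x))\<^sup>2 \<le> M * (\<Sum>j=m..<p. energy k j x)"
      by (rule gramian_partial_sum_le[OF M]) simp
    also have "\<dots> < e\<^sup>2"
      using N[OF that, of p] M(1) by (simp add: sum_nonneg energy_nonneg field_simps)
    finally show ?thesis using e by (auto intro: power2_less_imp_less)
  qed
  then show "\<exists>N. \<forall>m\<ge>N. \<forall>p. norm (\<Sum>j=m..<p. gramian_term n k C A j x) < e" by blast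
qed

lemmas gramian_symmetric = gramian_symmetric_if_summable[OF gramian_summable]
lemmas energy_sums = energy_sums_if_summable[OF gramian_summable]

lemma gramian_bounded_clinear: "bounded_clinear (gramian n k C A)"
proof -
  obtain M where M: "M > 0" "\<And>x. (\<Sum>j. energy k j x) \<le> M * (norm x)\<^sup>2"
    using energy_bounded by blast
  show ?thesis
  proof (rule bounded_clinearI[where K = M])
    show "gramian n k C A (x + y) = gramian n k C A x + gramian n k C A y" for x y
      by (rule eq_if_cinner_eq) (simp add: gramian_symmetric cinner.add_left)
    show "gramian n k C A (c *\<^sub>C x) = c *\<^sub>C gramian n k C A x" for c x
      by (rule eq_if_cinner_eq) (simp add: gramian_symmetric cinner_scaleC_left)
    show "norm (gramian n k C A x) \<le> norm x * M" for x
    proof (rule LIMSEQ_le_const2)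
      show "(\<lambda>m. norm (\<Sum>j<m. gramian_term n k C A j x)) \<longlonglongrightarrow> norm (gramian n k C A x)"
        unfolding gramian_def by (intro tendsto_norm summable_LIMSEQ gramian_summable)
      have "norm (\<Sum>j<m. gramian_term n k C A j x) \<le> norm x * M" for m
      proof (rule power2_le_imp_le)
        have "(norm (\<Sum>j<m. gramian_term n k C A j x))\<^sup>2 \<le> M * (\<Sum>j<m. energy k j x)"
          by (rule gramian_partial_sum_le[OF M]) simp
        also have "\<dots> \<le> M * (M * (norm x)\<^sup>2)"
          using M(1) order_trans[OF sum_le_suminf[OF energy_summable] M(2)]
          by (simp add: energy_nonneg)
        finally show "(norm (\<Sum>j<m. gramian_term n k C A j x))\<^sup>2 \<le> (norm x * M)\<^sup>2"
          by (simp add: power2_eq_square ac_simps)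
      qed (use M(1) in simp)
      then show "\<exists>N. \<forall>m\<ge>N. norm (\<Sum>j<m. gramian_term n k C A j x) \<le> norm x * M" by blast
    qed
  qed
qed

lemma gramian_coercive:
  "\<exists>\<delta>>0. \<forall>x. \<delta> * (norm x)\<^sup>2 \<le> Re (cinner (gramian n k C A x) x)"
  using energy_coercive[of k] sums_unique[OF energy_sums] by simp

lemma gramian_inverse:
  shows "gramian n k C A (inv (gramian n k C A) y) = y"
    and "bounded_clinear (inv (gramian n k C A))"
proof -
  obtain \<delta> where "\<delta> > 0" "\<And>x. \<delta> * (norm x)\<^sup>2 \<le> Re (cinner (gramian n k C A x) x)"
    using gramian_coercive by blast
  note inverse = coercive_symmetric_inverse[OF gramian_bounded_clinear gramian_symmetric this]
  show "gramian n k C A (inv (gramian n k C A) y) = y" by (rule inverse(1))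
  show "bounded_clinear (inv (gramian n k C A))" by (rule inverse(2))
qed

section \<open>The resolvent and the range of the shifted observability operator\<close>

lemma of_nat_choose: "of_nat ((n + j + k - 1) choose (j + k)) = complex_of_real (binom_weight n (j + k))"
  by (simp add: binom_weight_def add.assoc)

lemma resolvent_dominated:
  assumes "norm z < 1"
  shows "\<exists>q. summable q \<and>
    (\<forall>j x. norm ((of_real (binom_weight n (j + k)) * z ^ j) *\<^sub>C (A ^^ j) x) \<le> q j * norm x)"
proof -
  obtain B where B: "B > 0" "\<And>m x. norm ((A ^^ m) x) \<le> B * norm x"
    using power_bounded by blast
  define q where "q j = binom_weight n k * (binom_weight n j * norm z ^ j) * B" for j
  have "summable q"
    unfolding q_def using assms
    by (intro summable_mult2 summable_mult summable_binom_weight_power n) simp_all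
  moreover have "norm ((of_real (binom_weight n (j + k)) * z ^ j) *\<^sub>C (A ^^ j) x) \<le> q j * norm x" for j x
  proof -
    have "norm ((of_real (binom_weight n (j + k)) * z ^ j) *\<^sub>C (A ^^ j) x) =
        binom_weight n (j + k) * (norm z ^ j * norm ((A ^^ j) x))"
      by (simp add: norm_scaleC norm_mult norm_power weight_nonneg)
    also have "\<dots> \<le> (binom_weight n j * binom_weight n k) * (norm z ^ j * (B * norm x))"
      by (intro mult_mono mult_left_mono binom_weight_submult n B)
        (simp_all add: weight_nonneg)
    finally show ?thesis by (simp add: q_def ac_simps)
  qed
  ultimately show ?thesis by blast
qed

lemma resolvent_sums:
  assumes "norm z < 1"
  shows "(\<lambda>j. (of_real (binom_weight n (j + k)) * z ^ j) *\<^sub>C (A ^^ j) x) sums resolvent_op n k A z x"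
proof -
  obtain q where q: "summable q"
    "\<And>j x. norm ((of_real (binom_weight n (j + k)) * z ^ j) *\<^sub>C (A ^^ j) x) \<le> q j * norm x"
    using resolvent_dominated[OF assms, of k] by blast
  have "summable (\<lambda>j. (of_real (binom_weight n (j + k)) * z ^ j) *\<^sub>C (A ^^ j) x)"
    by (rule summable_comparison_test'[OF summable_mult2[OF q(1)] q(2)])
  then show ?thesis
    unfolding resolvent_op_def of_nat_choose by (rule summable_sums)
qed

lemma resolvent_bounded_clinear:
  assumes z: "norm z < 1"
  shows "bounded_clinear (resolvent_op n k A z)"
proof -
  obtain q where q: "summable q"
    "\<And>j x. norm ((of_real (binom_weight n (j + k)) * z ^ j) *\<^sub>C (A ^^ j) x) \<le> q j * norm x"
    using resolvent_dominated[OF assms, of k] by blast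
  note R = resolvent_sums[OF z, of k]
  show ?thesis
  proof (rule bounded_clinearI[where K = "suminf q"])
    show "resolvent_op n k A z (x + y) = resolvent_op n k A z x + resolvent_op n k A z y" for x y
      using R[of "x + y"] sums_add[OF R[of x] R[of y]]
      by (simp add: power_A_add scaleC_add_right sums_unique2)
    show "resolvent_op n k A z (c *\<^sub>C x) = c *\<^sub>C resolvent_op n k A z x" for c x
      using R[of "c *\<^sub>C x"] bounded_linear.sums[OF scaleC.bounded_linear_right R[of x], of c]
      by (simp add: power_A_scaleC scaleC_scaleC mult.commute sums_unique2)
    show "norm (resolvent_op n k A z x) \<le> norm x * suminf q" for x
    proof -
      have "norm (resolvent_op n k A z x) \<le> (\<Sum>j. q j * norm x)"
        unfolding sums_unique[OF R] by (rule norm_suminf_le[OF q(2) summable_mult2[OF q(1)]])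
      also have "\<dots> = norm x * suminf q"
        unfolding suminf_mult2[OF q(1), symmetric] by (rule mult.commute)
      finally show ?thesis .
    qed
  qed
qed

definition shifted_output :: "nat \<Rightarrow> 'x \<Rightarrow> complex \<Rightarrow> 'y"
  where "shifted_output k x = (bergman_shift ^^ k) (observability_op n k C A x)"

definition shifted_coeff :: "nat \<Rightarrow> 'x \<Rightarrow> nat \<Rightarrow> 'y"
  where "shifted_coeff k x j =
    (if j < k then 0 else of_real (binom_weight n j) *\<^sub>C out (j - k) x)"

lemma output_sums:
  assumes "norm z < 1"
  shows "(\<lambda>j. (of_real (binom_weight n (j + k)) * z ^ j) *\<^sub>C out j x) sums C (resolvent_op n k A z x)"
  using C.sums[OF resolvent_sums[OF assms, of k x]]
  by (simp add: bounded_clinear_scaleC[OF C])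

lemma shifted_output_eq:
  "shifted_output k x z = (if norm z < 1 then z ^ k *\<^sub>C C (resolvent_op n k A z x) else 0)"
  unfolding shifted_output_def funpow_bergman_shift observability_op_def of_nat_choose
  using output_sums[of z k x] by (simp add: sums_iff scaleC.zero_right)

lemma shifted_output_add: "shifted_output k (x + y) = (\<lambda>z. shifted_output k x z + shifted_output k y z)"
  and shifted_output_diff: "shifted_output k (x - y) = (\<lambda>z. shifted_output k x z - shifted_output k y z)"
  and shifted_output_scaleC: "shifted_output k (c *\<^sub>C x) = (\<lambda>z. c *\<^sub>C shifted_output k x z)"
proof -
  have lin: "bounded_clinear (\<lambda>x. z ^ k *\<^sub>C C (resolvent_op n k A z x))" if "norm z < 1" for z
    by (intro bounded_clinear_scaled bounded_clinear_compose[OF C] resolvent_bounded_clinear that)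
  note blin = bounded_clinear_bounded_linear[OF lin]
  show "shifted_output k (x + y) = (\<lambda>z. shifted_output k x z + shifted_output k y z)"
    using linear_add[OF bounded_linear.linear[OF blin], of _ x y] by (auto simp: shifted_output_eq)
  show "shifted_output k (x - y) = (\<lambda>z. shifted_output k x z - shifted_output k y z)"
    using linear_diff[OF bounded_linear.linear[OF blin], of _ x y] by (auto simp: shifted_output_eq)
  show "shifted_output k (c *\<^sub>C x) = (\<lambda>z. c *\<^sub>C shifted_output k x z)"
    using bounded_clinear_scaleC[OF lin, of _ c x] by (auto simp: shifted_output_eq scaleC.zero_right)
qed

lemma shifted_coeff_sums:
  assumes "norm z < 1"
  shows "(\<lambda>j. z ^ j *\<^sub>C shifted_coeff k x j) sums shifted_output k x z"
proof -
  have "(\<lambda>j. z ^ k *\<^sub>C (of_real (binom_weight n (j + k)) * z ^ j) *\<^sub>C out j x) sums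
      (z ^ k *\<^sub>C C (resolvent_op n k A z x))"
    by (rule bounded_linear.sums[OF scaleC.bounded_linear_right output_sums[OF assms]])
  then have "(\<lambda>j. z ^ (j + k) *\<^sub>C shifted_coeff k x (j + k)) sums shifted_output k x z"
    using assms by (simp add: shifted_output_eq shifted_coeff_def scaleC_scaleC power_add ac_simps)
  then show ?thesis
    by (subst (asm) sums_zero_iff_shift) (simp_all add: shifted_coeff_def scaleC.zero_right)
qed

lemma taylor_coeff_shifted_output: "taylor_coeff (shifted_output k x) = shifted_coeff k x"
  by (rule taylor_coeff_eq) (rule shifted_coeff_sums)

text \<open>
  Here the two weights meet: the coefficient of index \<open>j + k\<close> carries the square of
  \<open>binom_weight n (j + k)\<close>, the Bergman weight removes one factor, and what is left is
  the weight of the Gramian. So the Gramian is the Gram operator of the map onto the range.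
\<close>

lemma shifted_coeff_inner_sums:
  "(\<lambda>j. of_real (bergman_weight n j) * cinner (shifted_coeff k x j) (shifted_coeff k y j))
    sums cinner (gramian n k C A x) y"
proof -
  have "of_real (bergman_weight n (j + k)) *
      cinner (shifted_coeff k x (j + k)) (shifted_coeff k y (j + k)) =
      of_real (binom_weight n (j + k)) * cinner (out j x) (out j y)" for j
    using binom_weight_pos[OF n, of "j + k"]
    by (simp add: shifted_coeff_def bergman_weight_eq cinner_scaleC_left cinner_scaleC_right)
  then have "(\<lambda>j. of_real (bergman_weight n (j + k)) *
      cinner (shifted_coeff k x (j + k)) (shifted_coeff k y (j + k)))
      sums cinner (gramian n k C A x) y"
    using cinner_gramian_sums[OF gramian_summable] by simp
  then show ?thesis
    by (subst (asm) sums_zero_iff_shift) (simp_all add: shifted_coeff_def cinner.zero_left)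
qed

lemma shifted_coeff_norm_sums:
  "(\<lambda>j. bergman_weight n j * (norm (shifted_coeff k x j))\<^sup>2)
    sums Re (cinner (gramian n k C A x) x)"
  using bounded_linear.sums[OF bounded_linear_Re shifted_coeff_inner_sums[of k x x]]
  by (simp add: cinner_self)

lemma bergman_inner_shifted_output:
  "bergman_inner n (shifted_output k x) (shifted_output k y) = cinner (gramian n k C A x) y"
  using shifted_coeff_inner_sums[of k x y]
  by (simp add: bergman_inner_def taylor_coeff_shifted_output sums_iff)

lemma bergman_norm_shifted_output:
  "bergman_norm n (shifted_output k x) = sqrt (Re (cinner (gramian n k C A x) x))"
  using shifted_coeff_norm_sums[of k x]
  by (simp add: bergman_norm_def taylor_coeff_shifted_output sums_iff)

lemma shifted_output_in_bergman_space: "shifted_output k x \<in> bergman_space n"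
  unfolding bergman_space_def
  using shifted_coeff_sums[of _ k x] sums_summable[OF shifted_coeff_norm_sums[of k x]]
  by (auto simp: shifted_output_eq intro!: exI[of _ "shifted_coeff k x"])

text \<open>
  The map onto the range is bounded and bounded below, so Cauchy sequences and limits
  in the range correspond to Cauchy sequences and limits of state vectors.
\<close>

lemma range_shifted_output_hilbert_subspace:
  "bergman_hilbert_subspace n (range (shifted_output k))"
  unfolding bergman_hilbert_subspace_def
proof (intro conjI allI impI ballI)
  show "range (shifted_output k) \<subseteq> bergman_space n"
    using shifted_output_in_bergman_space by auto
  have "shifted_output k 0 = (\<lambda>_. 0)"
    using shifted_output_diff[of k 0 0] by simp
  then show "(\<lambda>_. 0) \<in> range (shifted_output k)" by (metis rangeI)
next
  fix f g assume "f \<in> range (shifted_output k)" "g \<in> range (shifted_output k)"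
  then show "(\<lambda>z. f z + g z) \<in> range (shifted_output k)"
    by (auto simp: shifted_output_add[symmetric])
next
  fix c f assume "f \<in> range (shifted_output k)"
  then show "(\<lambda>z. c *\<^sub>C f z) \<in> range (shifted_output k)"
    by (auto simp: shifted_output_scaleC[symmetric])
next
  fix F :: "nat \<Rightarrow> complex \<Rightarrow> 'y"
  assume "\<forall>i. F i \<in> range (shifted_output k)"
  then have "\<forall>i. \<exists>x. F i = shifted_output k x" by blast
  then obtain X where X: "\<And>i. F i = shifted_output k (X i)" by metis
  assume "\<forall>e>0. \<exists>N. \<forall>i\<ge>N. \<forall>j\<ge>N. bergman_norm n (\<lambda>z. F i z - F j z) < e"
  then have cauchy: "\<exists>N. \<forall>i\<ge>N. \<forall>j\<ge>N. bergman_norm n (shifted_output k (X i - X j)) < e"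
    if "e > 0" for e
    using that by (simp add: X shifted_output_diff)
  obtain \<delta> where \<delta>: "\<delta> > 0" "\<And>x. \<delta> * (norm x)\<^sup>2 \<le> Re (cinner (gramian n k C A x) x)"
    using gramian_coercive by blast
  have lower: "sqrt \<delta> * norm x \<le> bergman_norm n (shifted_output k x)" for x
    using real_sqrt_le_mono[OF \<delta>(2)[of x]]
    by (simp add: bergman_norm_shifted_output real_sqrt_mult)
  have "Cauchy X"
  proof (rule metric_CauchyI)
    fix e :: real assume "e > 0"
    then obtain N where N: "\<And>i j. i \<ge> N \<Longrightarrow> j \<ge> N \<Longrightarrow>
        bergman_norm n (shifted_output k (X i - X j)) < sqrt \<delta> * e"
      using cauchy[of "sqrt \<delta> * e"] \<delta>(1) by auto
    have "dist (X i) (X j) < e" if "i \<ge> N" "j \<ge> N" for i j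
      using le_less_trans[OF lower N[OF that]] \<delta>(1) by (simp add: dist_norm)
    then show "\<exists>M. \<forall>i\<ge>M. \<forall>j\<ge>M. dist (X i) (X j) < e" by blast
  qed
  then obtain x where x: "X \<longlonglongrightarrow> x" using Cauchy_convergent convergent_def by blast
  have "(\<lambda>i. X i - x) \<longlonglongrightarrow> 0" using x by (rule LIM_zero)
  then have "(\<lambda>i. sqrt (Re (cinner (gramian n k C A (X i - x)) (X i - x)))) \<longlonglongrightarrow>
      sqrt (Re (cinner (gramian n k C A 0) 0))"
    by (intro tendsto_real_sqrt tendsto_Re cinner.tendsto
        bounded_linear.tendsto[OF bounded_clinear_bounded_linear[OF gramian_bounded_clinear]])
  then have "(\<lambda>i. bergman_norm n (\<lambda>z. F i z - shifted_output k x z)) \<longlonglongrightarrow> 0"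
    by (simp add: X shifted_output_diff[symmetric] bergman_norm_shifted_output cinner.zero_right)
  then show "\<exists>f\<in>range (shifted_output k). (\<lambda>i. bergman_norm n (\<lambda>z. F i z - f z)) \<longlonglongrightarrow> 0"
    by blast
qed

section \<open>The reproducing kernel\<close>

text \<open>The state vector whose output is the kernel function at \<open>\<zeta>\<close> in direction \<open>y\<close>.\<close>

definition kernel_state :: "nat \<Rightarrow> complex \<Rightarrow> 'y \<Rightarrow> 'x"
  where "kernel_state k \<zeta> y = cnj \<zeta> ^ k *\<^sub>C
    inv (gramian n k C A) (cadjoint (resolvent_op n k A \<zeta>) (cadjoint C y))"

text \<open>
  The Gramian cancels the inverse inside the kernel state; moving the two adjoints across
  the inner product leaves the value of the output at \<open>\<zeta>\<close>.
\<close>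

lemma kernel_state_reproduces:
  assumes "norm \<zeta> < 1"
  shows "bergman_inner n (shifted_output k x) (shifted_output k (kernel_state k \<zeta> y)) =
    cinner (shifted_output k x \<zeta>) y"
proof -
  have "bergman_inner n (shifted_output k x) (shifted_output k (kernel_state k \<zeta> y)) =
      cinner x (gramian n k C A (kernel_state k \<zeta> y))"
    by (simp add: bergman_inner_shifted_output gramian_symmetric)
  also have "\<dots> = \<zeta> ^ k * cinner x (cadjoint (resolvent_op n k A \<zeta>) (cadjoint C y))"
    by (simp add: kernel_state_def bounded_clinear_scaleC[OF gramian_bounded_clinear]
        gramian_inverse(1) cinner_scaleC_right)
  also have "\<dots> = \<zeta> ^ k * cinner (C (resolvent_op n k A \<zeta> x)) y"
    by (simp add: cinner_cadjoint[OF C] cinner_cadjoint[OF resolvent_bounded_clinear[OF assms]])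
  finally show ?thesis
    using assms by (simp add: shifted_output_eq cinner_scaleC_left)
qed

lemma kernel_eq_shifted_output:
  assumes "norm z < 1"
  shows "(z ^ k * cnj \<zeta> ^ k) *\<^sub>C C (resolvent_op n k A z
      (inv (gramian n k C A) (cadjoint (resolvent_op n k A \<zeta>) (cadjoint C y)))) =
    shifted_output k (kernel_state k \<zeta> y) z"
  using assms
  by (simp add: shifted_output_eq kernel_state_def scaleC_scaleC bounded_clinear_scaleC[OF C]
      bounded_clinear_scaleC[OF resolvent_bounded_clinear[OF assms]])

end

theorem theorem5p6:
  fixes n k :: nat
    and C :: "'x::complex_hilbert \<Rightarrow> 'y::complex_hilbert"
    and A :: "'x \<Rightarrow> 'x"
  assumes "n \<ge> 1"
    and "bounded_clinear A"
    and "bounded_clinear C"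
    and "output_stable n C A"
    and "exactly_observable n C A"
  shows "reproducing_kernel n
    ((bergman_shift ^^ k) ` range (observability_op n k C A))
    (\<lambda>z \<zeta> y. (z ^ k * cnj \<zeta> ^ k) *\<^sub>C
      C (resolvent_op n k A z
          (inv (gramian n k C A)
            (cadjoint (resolvent_op n k A \<zeta>) (cadjoint C y)))))"
proof -
  interpret exactly_observable_pair n C A
    by unfold_locales (use assms in simp_all)
  have range: "(bergman_shift ^^ k) ` range (observability_op n k C A) = range (shifted_output k)"
    unfolding image_image shifted_output_def ..
  let ?K = "\<lambda>z \<zeta> y. (z ^ k * cnj \<zeta> ^ k) *\<^sub>C C (resolvent_op n k A z
    (inv (gramian n k C A) (cadjoint (resolvent_op n k A \<zeta>) (cadjoint C y))))"
  have kernel: "(\<lambda>z. if norm z < 1 then ?K z \<zeta> y else 0) =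
      shifted_output k (kernel_state k \<zeta> y)" for \<zeta> y
  proof
    show "(if norm z < 1 then ?K z \<zeta> y else 0) = shifted_output k (kernel_state k \<zeta> y) z" for z
      by (cases "norm z < 1") (simp_all only: kernel_eq_shifted_output shifted_output_eq if_True if_False)
  qed
  have "bounded_clinear (?K z \<zeta>)" if "norm z < 1" "norm \<zeta> < 1" for z \<zeta>
    by (intro bounded_clinear_scaled bounded_clinear_compose[OF C]
        bounded_clinear_compose[OF resolvent_bounded_clinear] that
        bounded_clinear_compose[OF gramian_inverse(2)]
        bounded_clinear_compose[OF bounded_clinear_cadjoint] bounded_clinear_cadjoint
        resolvent_bounded_clinear assms)
  then show ?thesis
    unfolding reproducing_kernel_def range kernel
    using range_shifted_output_hilbert_subspace kernel_state_reproduces by auto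
qed

end
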